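(* For all integers $1\le d\le n$ there exists a set $G\subset\mathbb{Z}^2$ with $|G|=n$ such that, for the discrete line intersection function $\mathrm{Int}_G|_{\mathcal{L}\times\mathcal{L}}$, each of the four quantities $$D(\mathrm{Int}_G|_{\mathcal{L}\times\mathcal{L}}),\quad D^{\rightarrow}(\mathrm{Int}_G|_{\mathcal{L}\times\mathcal{L}}),\quad R^{\rightarrow}(\mathrm{Int}_G|_{\mathcal{L}\times\mathcal{L}}),\quad R(\mathrm{Int}_G|_{\mathcal{L}\times\mathcal{L}})$$ is $\Theta\left(d\log\frac{n}{d}\right)$.
   Context: Communication complexity: for a function $f:\Omega_1\times\Omega_2\to\Omega$, Alice receives $x\in\Omega_1$, Bob receives $y\in\Omega_2$, and they exchange bits to compute $f(x,y)$. $D(f)$ is the minimum over deterministic protocols of the worst-case number of bits exchanged (any number of rounds). In the randomized setting Alice and Bob share an infinite public random string and on every input the output must be correct with probability at least $2/3$; $R(f)$ is the minimum worst-case number of bits exchanged by such a protocol. $D^{\rightarrow}(f)$ and $R^{\rightarrow}(f)$ are the one-way versions: only Alice sends a message to Bob, and Bob computes the output. Discrete line intersection: $L$ is the set of all lines in $\mathbb{R}^2$ and $\mathcal{L}$ is the collection of all $d$-element subsets of $L$. For a finite $G\subset\mathbb{Z}^2$ (known to both players), the function $\mathrm{Int}_G|_{\mathcal{L}\times\mathcal{L}}:\mathcal{L}\times\mathcal{L}\to 2^G$ is defined by $$\mathrm{Int}_G|_{\mathcal{L}\times\mathcal{L}}(\{\ell_1,\dots,\ell_d\},\{\ell'_1,\dots,\ell'_d\})=\bigcup_{i,j\in[d]}(\ell_i\cap\ell'_j\cap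 G).$$ Asymptotic notation: the constants implied in $\Theta$ are absolute (independent of $n$ and $d$), and the bounds are asserted whenever $n/d$ is at least some absolute constant. *)

theory Defs
  imports "HOL-Probability.Probability"
begin

text \<open>
  Protocol trees: at an inner node the indicated player sends one bit, computed from that player's
  input and (through the position in the tree) from the bits exchanged so far. The leaf reached,
  i.e. the transcript, determines the output.
\<close>

datatype ('x, 'y, 'z) protocol =
    Output 'z
  | Alice "'x \<Rightarrow> bool" "('x, 'y, 'z) protocol" "('x, 'y, 'z) protocol"
  | Bob "'y \<Rightarrow> bool" "('x, 'y, 'z) protocol" "('x, 'y, 'z) protocol"

primrec run :: "('x, 'y, 'z) protocol \<Rightarrow> 'x \<Rightarrow> 'y \<Rightarrow> 'z" where
  "run (Output z) x y = z"
| "run (Alice a P Q) x y = (if a x then run P x y else run Q x y)"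
| "run (Bob b P Q) x y = (if b y then run P x y else run Q x y)"

primrec bits :: "('x, 'y, 'z) protocol \<Rightarrow> 'x \<Rightarrow> 'y \<Rightarrow> nat" where
  "bits (Output z) x y = 0"
| "bits (Alice a P Q) x y = Suc (if a x then bits P x y else bits Q x y)"
| "bits (Bob b P Q) x y = Suc (if b y then bits P x y else bits Q x y)"

definition coins :: "(nat \<Rightarrow> bool) measure" where
  "coins = PiM UNIV (\<lambda>_. measure_pmf (bernoulli_pmf (1/2)))"

text \<open>
  The complexity measures below are those of \<open>f\<close> restricted to \<open>X \<times> Y\<close>. They take values in
  \<^typ>\<open>enat\<close>, so that the value is \<open>\<infinity>\<close> if no protocol of bounded cost exists.
\<close>

definition D_cc :: "'x set \<Rightarrow> 'y set \<Rightarrow> ('x \<Rightarrow> 'y \<Rightarrow> 'z) \<Rightarrow> enat" where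
  "D_cc X Y f = Inf {enat c | c. \<exists>P :: ('x, 'y, 'z) protocol.
     \<forall>x\<in>X. \<forall>y\<in>Y. bits P x y \<le> c \<and> run P x y = f x y}"

text \<open>
  A public-coin protocol chooses a deterministic protocol depending on the shared random string
  \<open>r\<close>; the cost bound holds for every \<open>r\<close>. Measurability is required only of the success events.
\<close>

definition R_cc :: "'x set \<Rightarrow> 'y set \<Rightarrow> ('x \<Rightarrow> 'y \<Rightarrow> 'z) \<Rightarrow> enat" where
  "R_cc X Y f = Inf {enat c | c. \<exists>P :: (nat \<Rightarrow> bool) \<Rightarrow> ('x, 'y, 'z) protocol.
     \<forall>x\<in>X. \<forall>y\<in>Y. (\<forall>r. bits (P r) x y \<le> c) \<and>
       {r. run (P r) x y = f x y} \<in> sets coins \<and>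
       measure coins {r. run (P r) x y = f x y} \<ge> 2/3}"

text \<open>
  In a one-way protocol Alice sends the message \<open>m x\<close> and Bob outputs \<open>g (m x) y\<close>. Messages have a
  fixed length: this amounts to messages forming a prefix-free code of length at most \<open>c\<close> (which
  can be padded), as in the tree model, so that the end of the message carries no information.
\<close>

definition D_oneway :: "'x set \<Rightarrow> 'y set \<Rightarrow> ('x \<Rightarrow> 'y \<Rightarrow> 'z) \<Rightarrow> enat" where
  "D_oneway X Y f = Inf {enat c | c. \<exists>(m :: 'x \<Rightarrow> bool list) (g :: bool list \<Rightarrow> 'y \<Rightarrow> 'z).
     \<forall>x\<in>X. \<forall>y\<in>Y. length (m x) = c \<and> g (m x) y = f x y}"

definition R_oneway :: "'x set \<Rightarrow> 'y set \<Rightarrow> ('x \<Rightarrow> 'y \<Rightarrow> 'z) \<Rightarrow> enat" where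
  "R_oneway X Y f = Inf {enat c | c. \<exists>(m :: (nat \<Rightarrow> bool) \<Rightarrow> 'x \<Rightarrow> bool list)
       (g :: (nat \<Rightarrow> bool) \<Rightarrow> bool list \<Rightarrow> 'y \<Rightarrow> 'z).
     \<forall>x\<in>X. \<forall>y\<in>Y. (\<forall>r. length (m r x) = c) \<and>
       {r. g r (m r x) y = f x y} \<in> sets coins \<and>
       measure coins {r. g r (m r x) y = f x y} \<ge> 2/3}"

definition lines :: "(real \<times> real) set set" where
  "lines = {l. affine l \<and> aff_dim l = 1}"

definition line_families :: "nat \<Rightarrow> (real \<times> real) set set set" where
  "line_families d = {A. A \<subseteq> lines \<and> finite A \<and> card A = d}"

definition line_int ::
  "(real \<times> real) set \<Rightarrow> (real \<times> real) set set \<Rightarrow> (real \<times> real) set set \<Rightarrow> (real \<times> real) set" where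
  "line_int G A B = (\<Union>l\<in>A. \<Union>l'\<in>B. l \<inter> l' \<inter> G)"

end

theory Submission
  imports Defs
begin

text \<open>
  Take for \<open>G\<close> a set of \<open>n\<close> collinear points. A line meets \<open>G\<close> in all of \<open>G\<close> or in at most one
  point, so \<open>d\<close> lines together meet it in \<open>G\<close> or in at most \<open>d\<close> points; there are only
  \<open>2^O(d log (n/d))\<close> such traces, and exchanging the traces solves the problem. Conversely, if one of
  Bob's lines contains \<open>G\<close>, then Alice can force any of the \<open>n choose d\<close> subsets of size \<open>d\<close> as
  the output, whereas for a fixed random string \<open>c\<close> bits lead to at most \<open>2^c\<close> outputs.
\<close>

section \<open>Protocols\<close>

text \<open>A tree node carries a single bit, so a message of fixed length becomes a block of nodes.
  The continuation \<open>k\<close> turns the word received into the rest of the protocol, which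
  lets blocks be chained.\<close>

primrec alice_sends ::
  "nat \<Rightarrow> ('x \<Rightarrow> bool list) \<Rightarrow> (bool list \<Rightarrow> ('x, 'y, 'z) protocol) \<Rightarrow> ('x, 'y, 'z) protocol" where
  "alice_sends 0 m k = k []"
| "alice_sends (Suc c) m k = Alice (\<lambda>x. hd (m x))
     (alice_sends c (\<lambda>x. tl (m x)) (\<lambda>w. k (True # w)))
     (alice_sends c (\<lambda>x. tl (m x)) (\<lambda>w. k (False # w)))"

primrec bob_sends ::
  "nat \<Rightarrow> ('y \<Rightarrow> bool list) \<Rightarrow> (bool list \<Rightarrow> ('x, 'y, 'z) protocol) \<Rightarrow> ('x, 'y, 'z) protocol" where
  "bob_sends 0 m k = k []"
| "bob_sends (Suc c) m k = Bob (\<lambda>y. hd (m y))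
     (bob_sends c (\<lambda>y. tl (m y)) (\<lambda>w. k (True # w)))
     (bob_sends c (\<lambda>y. tl (m y)) (\<lambda>w. k (False # w)))"

text \<open>Each step replaces \<open>m\<close> by its tail and moves the bit sent into
  \<open>k\<close>, so the induction on \<open>c\<close> must keep both arbitrary.\<close>

lemma alice_sends:
  assumes "length (m x) = c"
  shows "run (alice_sends c m k) x y = run (k (m x)) x y"
    and "bits (alice_sends c m k) x y = c + bits (k (m x)) x y"
proof -
  have "run (alice_sends c m k) x y = run (k (m x)) x y \<and>
        bits (alice_sends c m k) x y = c + bits (k (m x)) x y"
    using assms
  proof (induction c arbitrary: m k)
    case (Suc c)
    then obtain b w where "m x = b # w" "length w = c"
      by (cases "m x") auto
    then show ?case
      using Suc.IH[of "\<lambda>x. tl (m x)"] by (cases b) auto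
  qed auto
  then show "run (alice_sends c m k) x y = run (k (m x)) x y"
    and "bits (alice_sends c m k) x y = c + bits (k (m x)) x y"
    by auto
qed

lemma bob_sends:
  assumes "length (m y) = c"
  shows "run (bob_sends c m k) x y = run (k (m y)) x y"
    and "bits (bob_sends c m k) x y = c + bits (k (m y)) x y"
proof -
  have "run (bob_sends c m k) x y = run (k (m y)) x y \<and>
        bits (bob_sends c m k) x y = c + bits (k (m y)) x y"
    using assms
  proof (induction c arbitrary: m k)
    case (Suc c)
    then obtain b w where "m y = b # w" "length w = c"
      by (cases "m y") auto
    then show ?case
      using Suc.IH[of "\<lambda>y. tl (m y)"] by (cases b) auto
  qed auto
  then show "run (bob_sends c m k) x y = run (k (m y)) x y"
    and "bits (bob_sends c m k) x y = c + bits (k (m y)) x y"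
    by auto
qed

section \<open>Counting messages and outputs\<close>

lemma finite_bool_lists: "finite {w :: bool list. length w = c}"
  using finite_lists_length_eq[of "UNIV :: bool set" c] by simp

lemma card_bool_lists: "card {w :: bool list. length w = c} = 2 ^ c"
  using card_lists_length_eq[of "UNIV :: bool set" c] by simp

lemma encode_bool_list:
  assumes "finite F" "card F \<le> 2 ^ c"
  obtains e :: "'u \<Rightarrow> bool list" where "inj_on e F" "\<And>u. u \<in> F \<Longrightarrow> length (e u) = c"
proof -
  have "\<exists>e. inj_on e F \<and> e ` F \<subseteq> {w :: bool list. length w = c}"
    using inj_on_iff_card_le[OF assms(1) finite_bool_lists[of c]] assms(2)
    by (simp add: card_bool_lists)
  then show ?thesis
    using that by blast
qed

text \<open>With \<open>y\<close> fixed, only the nodes of Alice branch, so \<open>c\<close> bits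
  allow at most \<open>2 ^ c\<close> leaves. The cost bound sits inside the set because the tree may
  be deeper on other inputs, and \<open>X\<close> varies because a node of Alice splits it.\<close>

lemma run_outputs_finite: "finite {run P x y | x. x \<in> X \<and> bits P x y \<le> c}"
  and card_run_outputs_le: "card {run P x y | x. x \<in> X \<and> bits P x y \<le> c} \<le> 2 ^ c"
proof -
  have "finite {run P x y | x. x \<in> X \<and> bits P x y \<le> c} \<and>
        card {run P x y | x. x \<in> X \<and> bits P x y \<le> c} \<le> 2 ^ c"
  proof (induction P arbitrary: X c)
    case (Output z)
    let ?A = "{run (Output z) x y | x. x \<in> X \<and> bits (Output z) x y \<le> c}"
    have sub: "?A \<subseteq> {z}"
      by auto
    have "card ?A \<le> 1"
      using card_mono[OF _ sub] by simp
    also have "1 \<le> (2::nat) ^ c"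
      by simp
    finally show ?case
      using finite_subset[OF sub] by blast
  next
    case (Alice a P Q)
    show ?case
    \<comment> \<open>For \<open>c = 0\<close> no input meets the cost bound at an inner node, so
      the set is empty.\<close>
    proof (cases c)
      case (Suc c')
      let ?A = "{run P x y | x. x \<in> {x \<in> X. a x} \<and> bits P x y \<le> c'}"
      let ?B = "{run Q x y | x. x \<in> {x \<in> X. \<not> a x} \<and> bits Q x y \<le> c'}"
      have eq: "{run (Alice a P Q) x y | x. x \<in> X \<and> bits (Alice a P Q) x y \<le> c} = ?A \<union> ?B"
        unfolding Suc by (auto split: if_splits)
      have "card (?A \<union> ?B) \<le> 2 ^ c' + 2 ^ c'"
        using card_Un_le[of ?A ?B] Alice.IH[of "{x \<in> X. a x}" c'] Alice.IH[of "{x \<in> X. \<not> a x}" c']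
        by linarith
      then show ?thesis
        unfolding eq using Alice.IH[of "{x \<in> X. a x}" c'] Alice.IH[of "{x \<in> X. \<not> a x}" c'] Suc by simp
    qed simp
  next
    case (Bob b P Q)
    show ?case
    proof (cases c)
      case (Suc c')
      have "(2::nat) ^ c' \<le> 2 ^ c"
        using Suc by simp
      then show ?thesis
        \<comment> \<open>The bit \<open>b y\<close> is the same for all \<open>x\<close>: one
          subtree accounts for every output and nothing is doubled.\<close>
        using Bob.IH[of X c'] Suc by (cases "b y") auto
    qed simp
  qed
  then show "finite {run P x y | x. x \<in> X \<and> bits P x y \<le> c}"
    and "card {run P x y | x. x \<in> X \<and> bits P x y \<le> c} \<le> 2 ^ c"
    by auto
qed

section \<open>General bounds on the complexity measures\<close>

lemma prob_space_coins: "prob_space coins"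
  unfolding coins_def by (intro prob_space_PiM prob_space_measure_pmf)

lemma space_coins [simp]: "space coins = UNIV"
  by (simp add: coins_def space_PiM)

lemma coins_UNIV: "UNIV \<in> sets coins" "measure coins UNIV = 1"
  using prob_space.prob_space[OF prob_space_coins] sets.top[of coins] by auto

lemma R_cc_le_D_cc: "R_cc X Y f \<le> D_cc X Y f"
  unfolding R_cc_def D_cc_def
proof (rule Inf_superset_mono, safe)
  fix c and P :: "('a, 'b, 'c) protocol"
  assume P: "\<forall>x\<in>X. \<forall>y\<in>Y. bits P x y \<le> c \<and> run P x y = f x y"
  show "\<exists>c'. enat c = enat c' \<and> (\<exists>P :: (nat \<Rightarrow> bool) \<Rightarrow> ('a, 'b, 'c) protocol.
     \<forall>x\<in>X. \<forall>y\<in>Y. (\<forall>r. bits (P r) x y \<le> c') \<and>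
       {r. run (P r) x y = f x y} \<in> sets coins \<and>
       measure coins {r. run (P r) x y = f x y} \<ge> 2/3)"
    by (intro exI[of _ c] conjI refl exI[of _ "\<lambda>_. P"]) (use P coins_UNIV in auto)
qed

lemma R_oneway_le_D_oneway: "R_oneway X Y f \<le> D_oneway X Y f"
  unfolding R_oneway_def D_oneway_def
proof (rule Inf_superset_mono, safe)
  fix c and m :: "'a \<Rightarrow> bool list" and g :: "bool list \<Rightarrow> 'b \<Rightarrow> 'c"
  assume *: "\<forall>x\<in>X. \<forall>y\<in>Y. length (m x) = c \<and> g (m x) y = f x y"
  show "\<exists>c'. enat c = enat c' \<and> (\<exists>(m :: (nat \<Rightarrow> bool) \<Rightarrow> 'a \<Rightarrow> bool list)
       (g :: (nat \<Rightarrow> bool) \<Rightarrow> bool list \<Rightarrow> 'b \<Rightarrow> 'c).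
     \<forall>x\<in>X. \<forall>y\<in>Y. (\<forall>r. length (m r x) = c') \<and>
       {r. g r (m r x) y = f x y} \<in> sets coins \<and>
       measure coins {r. g r (m r x) y = f x y} \<ge> 2/3)"
    by (intro exI[of _ c] conjI refl exI[of _ "\<lambda>_. m"] exI[of _ "\<lambda>_. g"]) (use * coins_UNIV in auto)
qed

text \<open>The output at a leaf depends on the transcript alone, so both players send their
  summaries, in \<open>c\<close> bits each.\<close>

lemma D_cc_le_summaries:
  assumes "finite F" "card F \<le> 2 ^ c"
    and "\<And>x. x \<in> X \<Longrightarrow> u x \<in> F" "\<And>y. y \<in> Y \<Longrightarrow> v y \<in> F"
    and "\<And>x y. x \<in> X \<Longrightarrow> y \<in> Y \<Longrightarrow> f x y = h (u x) (v y)"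
  shows "D_cc X Y f \<le> enat (2 * c)"
proof -
  obtain e :: "_ \<Rightarrow> bool list" where e: "inj_on e F" "\<And>w. w \<in> F \<Longrightarrow> length (e w) = c"
    using encode_bool_list[OF assms(1,2)] by blast
  let ?P = "alice_sends c (\<lambda>x. e (u x)) (\<lambda>w. bob_sends c (\<lambda>y. e (v y))
     (\<lambda>w'. Output (h (inv_into F e w) (inv_into F e w'))))"
  have "bits ?P x y \<le> 2 * c \<and> run ?P x y = f x y" if "x \<in> X" "y \<in> Y" for x y
    using that assms(3-5) e
    by (simp add: alice_sends[of "\<lambda>x. e (u x)" x c] bob_sends[of "\<lambda>y. e (v y)" y c])
  then show ?thesis
    unfolding D_cc_def by (intro Inf_lower) blast
qed

text \<open>Bob computes the output from the message and his own \<open>y\<close>, so one summary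
  suffices.\<close>

lemma D_oneway_le_summary:
  assumes "finite F" "card F \<le> 2 ^ c"
    and "\<And>x. x \<in> X \<Longrightarrow> u x \<in> F"
    and "\<And>x y. x \<in> X \<Longrightarrow> y \<in> Y \<Longrightarrow> f x y = h (u x) y"
  shows "D_oneway X Y f \<le> enat c"
proof -
  obtain e :: "_ \<Rightarrow> bool list" where e: "inj_on e F" "\<And>w. w \<in> F \<Longrightarrow> length (e w) = c"
    using encode_bool_list[OF assms(1,2)] by blast
  let ?g = "\<lambda>w y. h (inv_into F e w) y"
  have "length (e (u x)) = c \<and> ?g (e (u x)) y = f x y" if "x \<in> X" "y \<in> Y" for x y
    using that assms(3,4) e by simp
  then have "\<exists>(m :: _ \<Rightarrow> bool list) g. \<forall>x\<in>X. \<forall>y\<in>Y. length (m x) = c \<and> g (m x) y = f x y"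
    by (intro exI[of _ "\<lambda>x. e (u x)"] exI[of _ ?g]) blast
  then show ?thesis
    unfolding D_oneway_def by (intro Inf_lower) blast
qed

text \<open>Double counting of the pairs of a guess and a successful random string.\<close>

lemma (in prob_space) card_le_of_guesses:
  fixes N :: nat
  assumes "finite I" "inj_on F I"
    and N: "\<And>r. finite (h r ` I)" "\<And>r. card (h r ` I) \<le> N"
    and E: "\<And>i. i \<in> I \<Longrightarrow> {r \<in> space M. h r i = F i} \<in> events"
    and p: "\<And>i. i \<in> I \<Longrightarrow> prob {r \<in> space M. h r i = F i} \<ge> p"
  shows "p * card I \<le> N"
proof -
  let ?E = "\<lambda>i. {r \<in> space M. h r i = F i}"
  have "p * card I = (\<Sum>i\<in>I. p)"
    by simp
  also have "\<dots> \<le> (\<Sum>i\<in>I. prob (?E i))"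
    using p by (rule sum_mono)
  also have "\<dots> = (\<Sum>i\<in>I. expectation (indicat_real (?E i)))"
    by (intro sum.cong refl) (use E in \<open>simp add: Int_absorb2\<close>)
  also have "\<dots> = expectation (\<lambda>r. \<Sum>i\<in>I. indicat_real (?E i) r)"
    using E by (intro Bochner_Integration.integral_sum [symmetric]) (simp add: emeasure_eq_measure)
  also have "\<dots> \<le> expectation (\<lambda>_. real N)"
  proof (rule integral_mono)
    fix r assume r: "r \<in> space M"
    have "(\<Sum>i\<in>I. indicat_real (?E i) r) = card {i \<in> I. h r i = F i}"
      using r \<open>finite I\<close> by (simp add: indicator_def sum.If_cases Int_def)
    \<comment> \<open>Since \<open>F\<close> is injective, indices guessed correctly have distinct
      guesses; hence at most \<open>N\<close> of them are correct for a given
      \<open>r\<close>.\<close>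
    also have "card {i \<in> I. h r i = F i} = card (F ` {i \<in> I. h r i = F i})"
      using \<open>inj_on F I\<close> by (intro card_image [symmetric]) (auto intro: inj_on_subset)
    also have "\<dots> \<le> card (h r ` I)"
      by (intro card_mono N) force
    also have "\<dots> \<le> N"
      by (rule N)
    finally show "(\<Sum>i\<in>I. indicat_real (?E i) r) \<le> real N"
      by simp
  qed (use E in \<open>auto simp: emeasure_eq_measure\<close>)
  finally show ?thesis
    by (simp add: prob_space)
qed

section \<open>Randomized lower bounds from the number of outputs\<close>

text \<open>If \<open>S\<close> is empty, its infimum is infinite and the bound is trivial;
  otherwise the infimum is attained by well-ordering.\<close>

lemma ereal_le_Inf_enat:
  assumes "\<And>c. enat c \<in> S \<Longrightarrow> a \<le> real c"
  shows "ereal a \<le> ereal_of_enat (Inf S)"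
proof (cases "Inf S")
  case (enat k)
  then have "S \<noteq> {}"
    by (auto simp: Inf_enat_def)
  then have "Inf S \<in> S"
    by (auto intro: wellorder_InfI)
  then show ?thesis
    using assms enat by simp
qed simp

text \<open>The factor \<open>3/2\<close> is at most 2, so success probability \<open>2/3\<close>
  costs at most one bit.\<close>

lemma le_of_two_thirds_le_power:
  assumes "2 / 3 * real k \<le> real (2 ^ c)" "k > 0"
  shows "log 2 k - 1 \<le> c"
proof -
  have "real k \<le> 2 powr (real c + 1)"
    using assms(1) by (simp add: powr_add powr_realpow)
  then have "log 2 k \<le> real c + 1"
    using assms(2) by (simp add: log_le_iff)
  then show ?thesis
    by simp
qed

text \<open>For every \<open>r\<close>, the tree \<open>P r\<close> yields at most
  \<open>2 ^ c\<close> outputs on the inputs \<open>x i\<close> against the fixed \<open>y\<close>,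
  while \<open>card I\<close> different values are each to be hit with probability
  \<open>2/3\<close>.\<close>

lemma R_cc_ge:
  fixes f :: "'x \<Rightarrow> 'y \<Rightarrow> 'z"
  assumes "finite I" "I \<noteq> {}" "inj_on (\<lambda>i. f (x i) y) I" "x ` I \<subseteq> X" "y \<in> Y"
  shows "ereal (log 2 (card I) - 1) \<le> ereal_of_enat (R_cc X Y f)"
  unfolding R_cc_def
proof (rule ereal_le_Inf_enat, safe)
  fix c and P :: "(nat \<Rightarrow> bool) \<Rightarrow> ('x, 'y, 'z) protocol"
  assume P: "\<forall>x\<in>X. \<forall>y\<in>Y. (\<forall>r. bits (P r) x y \<le> c) \<and>
     {r. run (P r) x y = f x y} \<in> sets coins \<and> measure coins {r. run (P r) x y = f x y} \<ge> 2/3"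
  \<comment> \<open>The cost condition holds for all these inputs; it is added to match
    \<open>card_run_outputs_le\<close>.\<close>
  have eq: "(\<lambda>i. run (P r) (x i) y) ` I = {run (P r) a y | a. a \<in> x ` I \<and> bits (P r) a y \<le> c}" for r
    using P assms(4,5) by blast
  have "2/3 * real (card I) \<le> real (2 ^ c)"
  proof (rule prob_space.card_le_of_guesses[OF prob_space_coins assms(1,3),
        where h = "\<lambda>r i. run (P r) (x i) y"])
    show "finite ((\<lambda>i. run (P r) (x i) y) ` I)" for r
      using assms(1) by simp
    show "card ((\<lambda>i. run (P r) (x i) y) ` I) \<le> 2 ^ c" for r
      unfolding eq by (rule card_run_outputs_le)
  qed (use P assms(4,5) in auto)
  then show "log 2 (card I) - 1 \<le> real c"
    using assms(1,2) by (intro le_of_two_thirds_le_power) (auto simp: card_gt_0_iff)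
qed

text \<open>For fixed \<open>r\<close> and \<open>y\<close> the guess is a function of the message,
  and there are \<open>2 ^ c\<close> messages.\<close>

lemma R_oneway_ge:
  fixes f :: "'x \<Rightarrow> 'y \<Rightarrow> 'z"
  assumes "finite I" "I \<noteq> {}" "inj_on (\<lambda>i. f (x i) y) I" "x ` I \<subseteq> X" "y \<in> Y"
  shows "ereal (log 2 (card I) - 1) \<le> ereal_of_enat (R_oneway X Y f)"
  unfolding R_oneway_def
proof (rule ereal_le_Inf_enat, safe)
  fix c and m :: "(nat \<Rightarrow> bool) \<Rightarrow> 'x \<Rightarrow> bool list" and g :: "(nat \<Rightarrow> bool) \<Rightarrow> bool list \<Rightarrow> 'y \<Rightarrow> 'z"
  assume *: "\<forall>x\<in>X. \<forall>y\<in>Y. (\<forall>r. length (m r x) = c) \<and>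
     {r. g r (m r x) y = f x y} \<in> sets coins \<and> measure coins {r. g r (m r x) y = f x y} \<ge> 2/3"
  have "2/3 * real (card I) \<le> real (2 ^ c)"
  proof (rule prob_space.card_le_of_guesses[OF prob_space_coins assms(1,3),
        where h = "\<lambda>r i. g r (m r (x i)) y"])
    fix r
    show "finite ((\<lambda>i. g r (m r (x i)) y) ` I)"
      using assms(1) by simp
    have "(\<lambda>i. g r (m r (x i)) y) ` I \<subseteq> (\<lambda>w. g r w y) ` {w. length w = c}"
      using * assms(4,5) by blast
    then have "card ((\<lambda>i. g r (m r (x i)) y) ` I) \<le> card {w :: bool list. length w = c}"
      using finite_bool_lists by (rule surj_card_le[rotated])
    then show "card ((\<lambda>i. g r (m r (x i)) y) ` I) \<le> 2 ^ c"
      by (simp add: card_bool_lists)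
  qed (use * assms(4,5) in auto)
  then show "log 2 (card I) - 1 \<le> real c"
    using assms(1,2) by (intro le_of_two_thirds_le_power) (auto simp: card_gt_0_iff)
qed

section \<open>Collinear points\<close>

definition axis_points :: "nat \<Rightarrow> (real \<times> real) set" where
  "axis_points n = (\<lambda>i. (real i, 0)) ` {..<n}"

text \<open>Written as a hyperplane so that the library facts on affinity and dimension of
  hyperplanes apply.\<close>

definition vertical_line :: "real \<Rightarrow> (real \<times> real) set" where
  "vertical_line a = {p. (1, 0) \<bullet> p = a}"

definition horizontal_line :: "real \<Rightarrow> (real \<times> real) set" where
  "horizontal_line a = {p. (0, 1) \<bullet> p = a}"

lemma mem_vertical_line [simp]: "(s, t) \<in> vertical_line a \<longleftrightarrow> s = a"
  and mem_horizontal_line [simp]: "(s, t) \<in> horizontal_line a \<longleftrightarrow> t = a"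
  by (auto simp: vertical_line_def horizontal_line_def)

lemma vertical_line_in_lines: "vertical_line a \<in> lines"
  and horizontal_line_in_lines: "horizontal_line a \<in> lines"
  by (auto simp: lines_def vertical_line_def horizontal_line_def affine_hyperplane
        aff_dim_hyperplane zero_prod_def)

lemma inj_vertical_line: "inj vertical_line"
  by (intro injI) (metis mem_vertical_line)

lemma inj_horizontal_line: "inj horizontal_line"
  by (intro injI) (metis mem_horizontal_line)

lemma finite_axis_points: "finite (axis_points n)"
  by (simp add: axis_points_def)

lemma card_axis_points: "card (axis_points n) = n"
  by (simp add: axis_points_def card_image inj_on_def)

lemma axis_points_integral: "axis_points n \<subseteq> \<int> \<times> \<int>"
  by (auto simp: axis_points_def)

text \<open>An affine set with two distinct points of the axis contains the line through them, which
  is the whole axis.\<close>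

lemma affine_Int_axis_points:
  assumes "affine l"
  shows "axis_points n \<subseteq> l \<or> card (l \<inter> axis_points n) \<le> 1"
proof (rule disjCI)
  assume "\<not> card (l \<inter> axis_points n) \<le> 1"
  then obtain p q where pq: "p \<in> l \<inter> axis_points n" "q \<in> l \<inter> axis_points n" "p \<noteq> q"
    using card_le_Suc0_iff_eq[of "l \<inter> axis_points n"] finite_axis_points by auto
  then obtain a b where ab: "p = (real a, 0)" "q = (real b, 0)" "a \<noteq> b"
    by (auto simp: axis_points_def)
  show "axis_points n \<subseteq> l"
  proof
    fix z assume "z \<in> axis_points n"
    then obtain i where i: "z = (real i, 0)"
      by (auto simp: axis_points_def)
    \<comment> \<open>The parameter of \<open>z\<close> on the line that passes through
      \<open>p\<close> at 0 and \<open>q\<close> at 1.\<close>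
    define t where "t = (real i - real a) / (real b - real a)"
    have "t * (real b - real a) = real i - real a"
      using ab(3) by (simp add: t_def)
    then have "(1 - t) *\<^sub>R p + t *\<^sub>R q = z"
      by (simp add: ab i algebra_simps)
    moreover have "(1 - t) *\<^sub>R p + t *\<^sub>R q \<in> l"
      using pq assms by (intro mem_affine) auto
    ultimately show "z \<in> l"
      by simp
  qed
qed

section \<open>Traces of line families and their number\<close>

definition traces :: "'a set \<Rightarrow> nat \<Rightarrow> 'a set set" where
  "traces G d = insert G {U. U \<subseteq> G \<and> card U \<le> d}"

lemma Union_lines_Int_axis_points:
  assumes "A \<in> line_families d"
  shows "\<Union>A \<inter> axis_points n \<in> traces (axis_points n) d"
proof (cases "\<exists>l\<in>A. axis_points n \<subseteq> l")
  case True
  then have "\<Union>A \<inter> axis_points n = axis_points n"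
    by blast
  then show ?thesis
    by (simp add: traces_def)
next
  case False
  have A: "finite A" "card A = d" "\<And>l. l \<in> A \<Longrightarrow> affine l"
    using assms by (auto simp: line_families_def lines_def)
  have "card (\<Union>A \<inter> axis_points n) = card (\<Union>l\<in>A. l \<inter> axis_points n)"
    by (simp add: Int_commute Int_Union)
  also have "\<dots> \<le> (\<Sum>l\<in>A. card (l \<inter> axis_points n))"
    using A(1) by (rule card_UN_le)
  also have "\<dots> \<le> (\<Sum>l\<in>A. 1)"
  proof (rule sum_mono)
    fix l assume "l \<in> A"
    then show "card (l \<inter> axis_points n) \<le> 1"
      using affine_Int_axis_points[OF A(3), of l n] False by blast
  qed
  finally show ?thesis
    using A(2) by (simp add: traces_def)
qed

text \<open>For \<open>t = d/n \<le> 1\<close> the weight \<open>t ^ d\<close> is at most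
  \<open>t ^ i\<close> when \<open>i \<le> d\<close>, so the weighted sum is at most
  \<open>(1 + t) ^ n\<close>, hence at most \<open>exp 1 ^ d\<close>. Rounding up to 4 gives a power
  of 2, convenient for counting bits.\<close>

lemma sum_binomial_le:
  assumes "1 \<le> d" "d \<le> n"
  shows "real (\<Sum>i\<le>d. n choose i) \<le> (4 * (real n / real d)) ^ d"
proof -
  let ?t = "real d / real n"
  have t: "0 < ?t" "?t \<le> 1"
    using assms by auto
  have "?t ^ d * real (\<Sum>i\<le>d. n choose i) = (\<Sum>i\<le>d. real (n choose i) * ?t ^ d)"
    by (simp add: sum_distrib_left mult.commute)
  also have "\<dots> \<le> (\<Sum>i\<le>d. real (n choose i) * ?t ^ i)"
    using t by (intro sum_mono mult_left_mono power_decreasing) auto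
  also have "\<dots> \<le> (\<Sum>i\<le>n. real (n choose i) * ?t ^ i)"
    using assms by (intro sum_mono2) auto
  also have "\<dots> = (1 + ?t) ^ n"
    using binomial_ring[of ?t 1 n] by (simp add: add.commute)
  also have "\<dots> \<le> exp ?t ^ n"
    using t by (intro power_mono) auto
  also have "\<dots> = exp 1 ^ d"
    using assms by (simp flip: exp_of_nat_mult)
  also have "\<dots> \<le> 4 ^ d"
    using exp_le by (intro power_mono) auto
  finally have "?t ^ d * real (\<Sum>i\<le>d. n choose i) \<le> 4 ^ d" .
  then show ?thesis
    using assms by (simp add: power_divide power_mult_distrib field_simps)
qed

lemma finite_traces: "finite G \<Longrightarrow> finite (traces G d)"
  by (auto simp: traces_def)

text \<open>The factor 2 absorbs the extra trace \<open>G\<close>, as the power is at least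
  1.\<close>

lemma card_traces_le:
  assumes "finite G" "1 \<le> d" "d \<le> card G"
  shows "real (card (traces G d)) \<le> 2 * (4 * (real (card G) / real d)) ^ d"
proof -
  have "{U. U \<subseteq> G \<and> card U \<le> d} = (\<Union>i\<le>d. {U. U \<subseteq> G \<and> card U = i})"
    by auto
  then have "card {U. U \<subseteq> G \<and> card U \<le> d} \<le> (\<Sum>i\<le>d. card {U. U \<subseteq> G \<and> card U = i})"
    by (simp add: card_UN_le)
  also have "\<dots> = (\<Sum>i\<le>d. card G choose i)"
    using assms by (simp add: n_subsets)
  finally have "card {U. U \<subseteq> G \<and> card U \<le> d} \<le> (\<Sum>i\<le>d. card G choose i)" .
  moreover have "card (traces G d) \<le> Suc (card {U. U \<subseteq> G \<and> card U \<le> d})"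
    unfolding traces_def by (rule card_insert_le_m1) auto
  ultimately have "real (card (traces G d)) \<le> 1 + real (\<Sum>i\<le>d. card G choose i)"
    by linarith
  moreover have "1 \<le> (4 * (real (card G) / real d)) ^ d"
    using assms by (intro one_le_power) (simp add: field_simps)
  ultimately show ?thesis
    using sum_binomial_le[OF assms(2,3)] by linarith
qed

text \<open>The threshold 4 makes the logarithm at least 2, so that the factor \<open>4 ^ d\<close>
  and the rounding are absorbed into the main term.\<close>

lemma traces_bits:
  assumes "finite G" "1 \<le> d" "real (card G) / real d \<ge> 4"
  obtains c where "card (traces G d) \<le> 2 ^ c"
    "real c \<le> 3 * (real d * log 2 (real (card G) / real d))"
proof -
  define q where "q = real (card G) / real d"
  define L where "L = real d * log 2 q"
  have q: "q \<ge> 4"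
    using assms by (simp add: q_def)
  then have "log 2 q \<ge> 2"
    by (simp add: le_log_iff)
  then have L: "L \<ge> 2 * real d"
    by (simp add: L_def mult_left_mono mult.commute)
  \<comment> \<open>The binary logarithm of \<open>2 * (4 * q) ^ d\<close>, rounded up.\<close>
  define c where "c = nat \<lceil>1 + 2 * real d + L\<rceil>"
  have c: "1 + 2 * real d + L \<le> real c" "real c \<le> 1 + (1 + 2 * real d + L)"
    unfolding c_def using L by linarith+
  have le: "d \<le> card G"
    using assms by (simp add: field_simps)
  have "real (card (traces G d)) \<le> 2 * (4 * q) ^ d"
    unfolding q_def using card_traces_le[OF assms(1,2) le] .
  also have "\<dots> = 2 powr (1 + 2 * real d + L)"
  proof -
    have "2 powr L = q ^ d"
      unfolding L_def using q by (simp add: powr_powr[symmetric] mult.commute[of "real d"] powr_realpow)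
    moreover have "2 powr (2 * real d) = (4::real) ^ d"
      by (simp add: powr_powr[symmetric] powr_realpow)
    ultimately show ?thesis
      by (simp add: powr_add power_mult_distrib)
  qed
  also have "\<dots> \<le> 2 powr real c"
    using c by simp
  finally have "real (card (traces G d)) \<le> real (2 ^ c)"
    by (simp add: powr_realpow)
  then have "card (traces G d) \<le> 2 ^ c"
    by (simp only: of_nat_le_iff)
  \<comment> \<open>Here \<open>c \<le> 2 + 2 * d + L\<close>, and
    \<open>2 \<le> 2 * d \<le> L\<close>.\<close>
  moreover have "real c \<le> 3 * L"
    using c(2) L assms(2) by linarith
  ultimately show ?thesis
    using that unfolding L_def q_def by blast
qed

section \<open>Bounds for line intersection on the axis points\<close>

text \<open>The output depends on each family only through its trace on \<open>G\<close>, so traces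
  can serve as the summaries.\<close>

lemma line_int_eq: "line_int G A B = (\<Union>A \<inter> G) \<inter> (\<Union>B \<inter> G)"
  by (auto simp: line_int_def)

text \<open>Two traces of at most \<open>3 * L\<close> bits each give the constant 6; the one-way
  bound is relaxed to the same constant.\<close>

lemma axis_points_upper:
  assumes "1 \<le> d" "real n / real d \<ge> 4"
  defines "f \<equiv> line_int (axis_points n)" and "X \<equiv> line_families d"
    and "L \<equiv> real d * log 2 (real n / real d)"
  shows "ereal_of_enat (D_cc X X f) \<le> ereal (6 * L)"
    and "ereal_of_enat (D_oneway X X f) \<le> ereal (6 * L)"
proof -
  let ?F = "traces (axis_points n) d"
  have F: "finite ?F"
    by (intro finite_traces finite_axis_points)
  obtain c where c: "card ?F \<le> 2 ^ c" "real c \<le> 3 * L"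
    using traces_bits[OF finite_axis_points assms(1), of n] assms(2)
    unfolding card_axis_points L_def by blast
  have "D_cc X X f \<le> enat (2 * c)"
    by (rule D_cc_le_summaries[OF F c(1), where h = "(\<inter>)"])
      (simp_all add: X_def f_def Union_lines_Int_axis_points line_int_eq)
  then have "ereal_of_enat (D_cc X X f) \<le> ereal (real (2 * c))"
    by (metis ereal_of_enat_le_iff ereal_of_enat_simps(1))
  also have "\<dots> \<le> ereal (6 * L)"
    using c(2) by simp
  finally show "ereal_of_enat (D_cc X X f) \<le> ereal (6 * L)" .
  have "D_oneway X X f \<le> enat c"
    by (rule D_oneway_le_summary[OF F c(1), where h = "\<lambda>U B. U \<inter> (\<Union>B \<inter> axis_points n)"])
      (simp_all add: X_def f_def Union_lines_Int_axis_points line_int_eq)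
  then have "ereal_of_enat (D_oneway X X f) \<le> ereal (real c)"
    by (metis ereal_of_enat_le_iff ereal_of_enat_simps(1))
  also have "\<dots> \<le> ereal (6 * L)"
    using c(2) by simp
  finally show "ereal_of_enat (D_oneway X X f) \<le> ereal (6 * L)" .
qed

lemma axis_points_lower:
  assumes "1 \<le> d" "real n / real d \<ge> 4"
  defines "f \<equiv> line_int (axis_points n)" and "X \<equiv> line_families d"
    and "L \<equiv> real d * log 2 (real n / real d)"
  shows "ereal (1/2 * L) \<le> ereal_of_enat (R_cc X X f)"
    and "ereal (1/2 * L) \<le> ereal_of_enat (R_oneway X X f)"
proof -
  define I where "I = {S. S \<subseteq> {..<n} \<and> card S = d}"
  define x where "x = (\<lambda>S. (\<lambda>i. vertical_line (real i)) ` S)"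
  \<comment> \<open>The line with \<open>i = 0\<close> is the axis itself, available as
    \<open>d \<ge> 1\<close>; the others are parallel to it, miss the points and only bring the
    family to size \<open>d\<close>.\<close>
  define y where "y = (\<lambda>i. horizontal_line (real i)) ` {..<d}"
  have inj: "inj (\<lambda>i. vertical_line (real i))" "inj (\<lambda>i. horizontal_line (real i))"
    by (auto intro!: injI dest: injD[OF inj_vertical_line] injD[OF inj_horizontal_line])
  have le: "d \<le> n"
    using assms(1,2) by (simp add: field_simps)
  have I: "finite I" "card I = n choose d"
    by (auto simp: I_def n_subsets)
  then have ne: "I \<noteq> {}"
    using le by (metis binomial_eq_0_iff card.empty not_le)
  have xX: "x ` I \<subseteq> X"
    by (auto simp: x_def X_def I_def line_families_def vertical_line_in_lines
        card_image[OF inj_on_subset[OF inj(1)]] intro: finite_subset)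
  have yX: "y \<in> X"
    by (auto simp: y_def X_def line_families_def horizontal_line_in_lines
        card_image[OF inj_on_subset[OF inj(2)]])
  have fxy: "f (x S) y = (\<lambda>i. (real i, 0)) ` S" if "S \<in> I" for S
    using that assms(1) by (force simp: f_def line_int_eq x_def y_def I_def axis_points_def)
  have inj_f: "inj_on (\<lambda>S. f (x S) y) I"
  proof (rule inj_onI)
    fix S T assume "S \<in> I" "T \<in> I" "f (x S) y = f (x T) y"
    then have "(\<lambda>i. (real i, 0::real)) ` S = (\<lambda>i. (real i, 0)) ` T"
      by (simp add: fxy)
    moreover have "inj (\<lambda>i. (real i, 0::real))"
      by (simp add: inj_def)
    ultimately show "S = T"
      by (simp add: inj_image_eq_iff)
  qed
  have "log 2 (real n / real d) \<ge> 2"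
    using assms(2) by (simp add: le_log_iff)
  then have L2: "L \<ge> 2"
    using assms(1) mult_mono[of 1 "real d" 2 "log 2 (real n / real d)"] by (simp add: L_def)
  have pos: "real n / real d > 0"
    using assms(2) by linarith
  have "L = log 2 ((real n / real d) ^ d)"
    using pos by (simp only: L_def log_nat_power)
  \<comment> \<open>Uses \<open>(n/d) ^ d \<le> n choose d\<close>.\<close>
  also have "\<dots> \<le> log 2 (real (card I))"
    unfolding I(2) using binomial_ge_n_over_k_pow_k[OF le, where ?'a = real] zero_less_power[OF pos]
    by (intro log_mono) simp_all
  \<comment> \<open>The lost bit is at most \<open>L/2\<close>, because
    \<open>L \<ge> 2\<close>.\<close>
  finally have "1/2 * L \<le> log 2 (card I) - 1"
    using L2 by simp
  then have L: "ereal (1/2 * L) \<le> ereal (log 2 (card I) - 1)"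
    by simp
  show "ereal (1/2 * L) \<le> ereal_of_enat (R_cc X X f)"
    using L R_cc_ge[where f = f and x = x, OF I(1) ne inj_f xX yX]
    by (rule order_trans)
  show "ereal (1/2 * L) \<le> ereal_of_enat (R_oneway X X f)"
    using L R_oneway_ge[where f = f and x = x, OF I(1) ne inj_f xX yX]
    by (rule order_trans)
qed

text \<open>Lower bounds are needed only for the randomized measures and upper bounds only for the
  deterministic ones: in each model the randomized cost is at most the deterministic one.\<close>

theorem theorem5:
  "\<exists>(c::real) (C::real) (K::real). 0 < c \<and> 0 < C \<and>
     (\<forall>(d::nat) (n::nat). 1 \<le> d \<and> d \<le> n \<longrightarrow>
       (\<exists>G :: (real \<times> real) set. G \<subseteq> \<int> \<times> \<int> \<and> finite G \<and> card G = n \<and>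
         (real n / real d \<ge> K \<longrightarrow>
           (\<forall>q \<in> {D_cc (line_families d) (line_families d) (line_int G),
                   D_oneway (line_families d) (line_families d) (line_int G),
                   R_oneway (line_families d) (line_families d) (line_int G),
                   R_cc (line_families d) (line_families d) (line_int G)}.
              ereal (c * (real d * log 2 (real n / real d))) \<le> ereal_of_enat q \<and>
              ereal_of_enat q \<le> ereal (C * (real d * log 2 (real n / real d)))))))"
proof -
  have bounds: "\<forall>q \<in> {D_cc (line_families d) (line_families d) (line_int (axis_points n)),
                 D_oneway (line_families d) (line_families d) (line_int (axis_points n)),
                 R_oneway (line_families d) (line_families d) (line_int (axis_points n)),
                 R_cc (line_families d) (line_families d) (line_int (axis_points n))}.
          ereal (1/2 * (real d * log 2 (real n / real d))) \<le> ereal_of_enat q \<and>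
          ereal_of_enat q \<le> ereal (6 * (real d * log 2 (real n / real d)))"
    if "1 \<le> d" "real n / real d \<ge> 4" for d n :: nat
  proof -
    let ?X = "line_families d" and ?f = "line_int (axis_points n)"
    have le: "ereal_of_enat (R_cc ?X ?X ?f) \<le> ereal_of_enat (D_cc ?X ?X ?f)"
      "ereal_of_enat (R_oneway ?X ?X ?f) \<le> ereal_of_enat (D_oneway ?X ?X ?f)"
      by (simp_all add: R_cc_le_D_cc R_oneway_le_D_oneway)
    note lower = axis_points_lower[OF that] and upper = axis_points_upper[OF that]
    show ?thesis
      by (intro ballI, elim insertE emptyE)
        (simp_all only: lower upper order_trans[OF lower(1) le(1)] order_trans[OF lower(2) le(2)]
          order_trans[OF le(1) upper(1)] order_trans[OF le(2) upper(2)] simp_thms)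
  qed
  show ?thesis
  proof (rule exI[of _ "1/2"], rule exI[of _ 6], rule exI[of _ 4], intro conjI allI impI)
    fix d n :: nat
    assume "1 \<le> d \<and> d \<le> n"
    then show "\<exists>G :: (real \<times> real) set. G \<subseteq> \<int> \<times> \<int> \<and> finite G \<and> card G = n \<and>
         (real n / real d \<ge> 4 \<longrightarrow>
           (\<forall>q \<in> {D_cc (line_families d) (line_families d) (line_int G),
                   D_oneway (line_families d) (line_families d) (line_int G),
                   R_oneway (line_families d) (line_families d) (line_int G),
                   R_cc (line_families d) (line_families d) (line_int G)}.
              ereal (1/2 * (real d * log 2 (real n / real d))) \<le> ereal_of_enat q \<and>
              ereal_of_enat q \<le> ereal (6 * (real d * log 2 (real n / real d)))))"
      by (intro exI[of _ "axis_points n"] conjI impI axis_points_integral finite_axis_points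
          card_axis_points bounds) simp_all
  qed simp_all
qed

end
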